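(* Let $a\geq0$ and $b\geq1$ be integers and let $\Lambda(a,b,0,1)$ be the digraph with vertices $u_1,\dots,u_a,w_1,\dots,w_b,v$ whose arcs are $(u_i,u_{i'})$ for $i\neq i'$, $(u_i,w_j)$, $(w_j,v)$, $(v,w_j)$ and $(v,u_i)$ for all $i,j$. Then the Smith normal form of its distance matrix $D(\Lambda(a,b,0,1))$ is $I_{a+2}\oplus 2I_{b-2}\oplus[8a+2b]$ if $b\geq 2$, and is $I_{a+1}\oplus[4a+1]$ if $b=1$.
   Context: The distance matrix $D$ has $uv$-entry equal to the number of arcs of a shortest directed walk from $u$ to $v$. The Smith normal form of a square integer matrix $M$ is the unique diagonal matrix $\operatorname{diag}(f_1,\dots,f_r,0,\dots,0)$ with $f_i>0$, $f_i\mid f_{i+1}$, obtainable as $PMQ$ with $P,Q\in GL_n(\mathbb{Z})$. $I_m$ denotes the $m\times m$ identity matrix, $\oplus$ the block diagonal sum, and $[c]$ the $1\times1$ matrix with entry $c$. *)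

theory Defs
  imports Graph_Theory.Arc_Walk Jordan_Normal_Form.Matrix
begin

(* On an unreachable pair the LEAST is unspecified; Lambda01 a b below is
   strongly connected for b >= 1. *)
definition digraph_dist :: "('a, 'b) pre_digraph \<Rightarrow> 'a \<Rightarrow> 'a \<Rightarrow> nat" where
  "digraph_dist G u v = (LEAST k. \<exists>p. pre_digraph.awalk G u p v \<and> length p = k)"

(* The rows and columns are ordered by a list enumerating the vertices. *)
definition distance_mat :: "('a, 'b) pre_digraph \<Rightarrow> 'a list \<Rightarrow> int mat" where
  "distance_mat G vs =
     mat (length vs) (length vs) (\<lambda>(i, j). int (digraph_dist G (vs ! i) (vs ! j)))"

(* For integer matrices, invertible_mat asks for an integer inverse, so P and Q
   range over GL_n(Z).  The list fs holds the nonzero diagonal entries. *)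
definition is_smith_normal_form :: "int mat \<Rightarrow> int mat \<Rightarrow> bool" where
  "is_smith_normal_form M S \<longleftrightarrow>
     (\<exists>n fs P Q.
        M \<in> carrier_mat n n \<and>
        length fs \<le> n \<and>
        (\<forall>f \<in> set fs. f > 0) \<and>
        (\<forall>i. Suc i < length fs \<longrightarrow> fs ! i dvd fs ! Suc i) \<and>
        S = mat_diag n (\<lambda>i. if i < length fs then fs ! i else 0) \<and>
        P \<in> carrier_mat n n \<and> invertible_mat P \<and>
        Q \<in> carrier_mat n n \<and> invertible_mat Q \<and>
        S = P * M * Q)"

datatype lambda_vertex = U nat | W nat | V

(* The digraph Lambda(a,b,0,1), with arcs represented as pairs (tail, head). *)
definition Lambda01 ::
    "nat \<Rightarrow> nat \<Rightarrow> (lambda_vertex, lambda_vertex \<times> lambda_vertex) pre_digraph" where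
  "Lambda01 a b =
     \<lparr> verts = U ` {1..a} \<union> W ` {1..b} \<union> {V},
       arcs = {(U i, U i') | i i'. i \<in> {1..a} \<and> i' \<in> {1..a} \<and> i \<noteq> i'}
            \<union> {(U i, W j) | i j. i \<in> {1..a} \<and> j \<in> {1..b}}
            \<union> {(W j, V) | j. j \<in> {1..b}}
            \<union> {(V, W j) | j. j \<in> {1..b}}
            \<union> {(V, U i) | i. i \<in> {1..a}},
       tail = fst,
       head = snd \<rparr>"

end

theory Submission imports Defs
begin

text \<open>
  Integer row and column operations bring \<open>D\<close> to a signed generalized permutation matrix, which
  signs and reorderings of the rows and columns turn into the required diagonal matrix.  Each
  operation is a transvection \<open>I + x y\<^sup>T\<close> with \<open>y\<^sup>T x = 0\<close>, hence unimodular with inverse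
  \<open>I - x y\<^sup>T\<close>.  Matrices are indexed by vertices, so that the position of a vertex in the given
  enumeration never matters.
\<close>

section \<open>Unimodular equivalence\<close>

definition unimodular_equiv :: "int mat \<Rightarrow> int mat \<Rightarrow> bool" (infix "\<approx>\<^sub>u" 50) where
  "A \<approx>\<^sub>u B \<longleftrightarrow> (\<exists>n P Q. A \<in> carrier_mat n n \<and>
     P \<in> carrier_mat n n \<and> invertible_mat P \<and>
     Q \<in> carrier_mat n n \<and> invertible_mat Q \<and> B = P * A * Q)"

lemma invertible_mat_mult:
  fixes P Q :: "'a::semiring_1 mat"
  assumes P: "P \<in> carrier_mat n n" "invertible_mat P"
    and Q: "Q \<in> carrier_mat n n" "invertible_mat Q"
  shows "invertible_mat (P * Q)"
proof -
  obtain P' where P': "P * P' = 1\<^sub>m n" "P' * P = 1\<^sub>m (dim_row P')"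
    using P unfolding invertible_mat_def inverts_mat_def by auto
  obtain Q' where Q': "Q * Q' = 1\<^sub>m n" "Q' * Q = 1\<^sub>m (dim_row Q')"
    using Q unfolding invertible_mat_def inverts_mat_def by auto
  \<comment> \<open>\<open>invertible_mat\<close> leaves the size of the inverse open; comparing
    column counts in the two products forces it to be \<open>n\<close> by \<open>n\<close>.\<close>
  have cP: "P' \<in> carrier_mat n n"
    using P P' by (metis carrier_matD(2) carrier_matI index_mult_mat(3) index_one_mat(3))
  have cQ: "Q' \<in> carrier_mat n n"
    using Q Q' by (metis carrier_matD(2) carrier_matI index_mult_mat(3) index_one_mat(3))
  note c = P(1) Q(1) cP cQ
  have "P * Q * (Q' * P') = P * (Q * Q') * P'"
    using c by (simp add: assoc_mult_mat[of _ n n _ n _ n])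
  then have 1: "P * Q * (Q' * P') = 1\<^sub>m n" using c P' Q' by simp
  have "Q' * P' * (P * Q) = Q' * (P' * P) * Q"
    using c by (simp add: assoc_mult_mat[of _ n n _ n _ n])
  then have 2: "Q' * P' * (P * Q) = 1\<^sub>m n" using c P' Q' by simp
  show ?thesis
    unfolding invertible_mat_def inverts_mat_def using c 1 2
    by (intro conjI exI[of _ "Q' * P'"]) auto
qed

lemma unimodular_equiv_trans [trans]:
  assumes "A \<approx>\<^sub>u B" "B \<approx>\<^sub>u C" shows "A \<approx>\<^sub>u C"
proof -
  obtain n P Q where 1: "A \<in> carrier_mat n n" "P \<in> carrier_mat n n" "invertible_mat P"
     "Q \<in> carrier_mat n n" "invertible_mat Q" "B = P * A * Q"
    using assms(1) unfolding unimodular_equiv_def by blast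
  obtain m P' Q' where "B \<in> carrier_mat m m" and
     2: "P' \<in> carrier_mat m m" "invertible_mat P'"
     "Q' \<in> carrier_mat m m" "invertible_mat Q'" "C = P' * B * Q'"
    using assms(2) unfolding unimodular_equiv_def by blast
  then have mn: "m = n" using 1 by auto
  have "C = (P' * P) * A * (Q * Q')"
    using 1 2 unfolding mn by (simp add: assoc_mult_mat[of _ n n _ n _ n])
  moreover have "invertible_mat (P' * P)" "invertible_mat (Q * Q')"
    using 1 2 unfolding mn by (auto intro: invertible_mat_mult)
  ultimately show ?thesis
    unfolding unimodular_equiv_def using 1 2 unfolding mn
    by (intro exI[of _ n] exI[of _ "P' * P"] exI[of _ "Q * Q'"]) simp
qed

section \<open>Matrices indexed by lists\<close>

text \<open>Separate lists for rows and columns let a reordering be a change of list, with the entry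
  function left alone.\<close>

definition list_mat :: "'r list \<Rightarrow> 'c list \<Rightarrow> ('r \<Rightarrow> 'c \<Rightarrow> 'a) \<Rightarrow> 'a mat" where
  "list_mat rs cs f = mat (length rs) (length cs) (\<lambda>(i, j). f (rs ! i) (cs ! j))"

lemma list_mat_carrier [simp]: "list_mat rs cs f \<in> carrier_mat (length rs) (length cs)"
  by (simp add: list_mat_def)

lemma list_mat_cong:
  assumes "\<And>r c. r \<in> set rs \<Longrightarrow> c \<in> set cs \<Longrightarrow> f r c = g r c"
  shows "list_mat rs cs f = list_mat rs cs g"
  using assms by (auto simp: list_mat_def)

text \<open>Distinctness turns the sum over positions into a sum over a set, which no longer depends
  on the order of the enumeration.\<close>

lemma list_mat_mult:
  fixes p :: "'r \<Rightarrow> 'k \<Rightarrow> 'a::semiring_0"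
  assumes "distinct ks"
  shows "list_mat rs ks p * list_mat ks cs f = list_mat rs cs (\<lambda>r c. \<Sum>k\<in>set ks. p r k * f k c)"
proof -
  have "(\<Sum>k\<in>set ks. h k) = (\<Sum>i = 0..<length ks. h (ks ! i))" for h :: "_ \<Rightarrow> 'a"
    using assms by (simp add: sum.distinct_set_conv_list sum_list_sum_nth)
  then show ?thesis
    by (auto simp: list_mat_def scalar_prod_def)
qed

lemma list_mat_one: "distinct rs \<Longrightarrow> list_mat rs rs (\<lambda>r c. of_bool (r = c)) = 1\<^sub>m (length rs)"
  by (auto simp: list_mat_def nth_eq_iff_index_eq)

lemma invertible_list_mat:
  fixes p :: "'r \<Rightarrow> 'c \<Rightarrow> 'a::semiring_1"
  assumes d: "distinct rs" "distinct cs" and len: "length rs = length cs"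
    and "\<And>r r'. r \<in> set rs \<Longrightarrow> r' \<in> set rs \<Longrightarrow>
          (\<Sum>k\<in>set cs. p r k * p' k r') = of_bool (r = r')"
    and "\<And>c c'. c \<in> set cs \<Longrightarrow> c' \<in> set cs \<Longrightarrow>
          (\<Sum>k\<in>set rs. p' c k * p k c') = of_bool (c = c')"
  shows "invertible_mat (list_mat rs cs p)"
proof -
  have 1: "list_mat rs cs p * list_mat cs rs p' = 1\<^sub>m (length rs)"
    unfolding list_mat_mult[OF d(2)] list_mat_one[OF d(1), symmetric]
    by (rule list_mat_cong) (use assms in auto)
  have 2: "list_mat cs rs p' * list_mat rs cs p = 1\<^sub>m (length cs)"
    unfolding list_mat_mult[OF d(1)] list_mat_one[OF d(2), symmetric]
    by (rule list_mat_cong) (use assms in auto)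
  from 1 2 show ?thesis
    unfolding invertible_mat_def inverts_mat_def using len
    by (intro conjI exI[of _ "list_mat cs rs p'"]) (auto simp: list_mat_def)
qed

section \<open>Transvections and signed reorderings\<close>

lemma invertible_one_mat: "invertible_mat (1\<^sub>m n :: 'a::semiring_1 mat)"
  unfolding invertible_mat_def inverts_mat_def
  by (intro conjI exI[of _ "1\<^sub>m n"]) auto

lemma invertible_transvection:
  fixes x y :: "'a \<Rightarrow> int"
  assumes d: "distinct vs" and xy: "(\<Sum>k\<in>set vs. y k * x k) = 0"
  shows "invertible_mat (list_mat vs vs (\<lambda>r c. of_bool (r = c) + x r * y c))"
proof (rule invertible_list_mat[OF d d refl, where p' = "\<lambda>r c. of_bool (r = c) - x r * y c"])
  \<comment> \<open>Taking \<open>e = 1\<close> and \<open>e = -1\<close> gives the two orders of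
    the product with the inverse. The linear terms cancel, and the quadratic one contains the factor
    \<open>y k * x k\<close> summed over \<open>k\<close>, which is zero.\<close>
  have *: "(\<Sum>k\<in>set vs. (of_bool (r = k) + e * x r * y k) * (of_bool (k = r') - e * x k * y r'))
       = of_bool (r = r')" if "r \<in> set vs" "r' \<in> set vs" for r r' and e :: int
  proof -
    have "(\<Sum>k\<in>set vs. (of_bool (r = k) + e * x r * y k) * (of_bool (k = r') - e * x k * y r'))
        = (\<Sum>k\<in>set vs. of_bool (r = k) * of_bool (k = r')) 
          - (\<Sum>k\<in>set vs. if r = k then e * x k * y r' else 0)
          + (\<Sum>k\<in>set vs. if r' = k then e * x r * y k else 0) 
          - (\<Sum>k\<in>set vs. e * e * x r * y r' * (y k * x k))"
      unfolding sum.distrib[symmetric] sum_subtractf[symmetric]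
      by (rule sum.cong) (auto simp: algebra_simps)
    also have "(\<Sum>k\<in>set vs. of_bool (r = k) * of_bool (k = r') :: int)
        = (\<Sum>k\<in>set vs. if r = k then of_bool (r = r') else 0)"
      by (rule sum.cong) auto
    also have "(\<Sum>k\<in>set vs. e * e * x r * y r' * (y k * x k)) = 0"
      unfolding sum_distrib_left[symmetric] xy by simp
    finally show ?thesis using that by simp
  qed
  show "(\<Sum>k\<in>set vs. (of_bool (r = k) + x r * y k) * (of_bool (k = r') - x k * y r'))
       = of_bool (r = r')" if "r \<in> set vs" "r' \<in> set vs" for r r'
    using *[OF that, of 1] by simp
  show "(\<Sum>k\<in>set vs. (of_bool (r = k) - x r * y k) * (of_bool (k = r') + x k * y r'))
       = of_bool (r = r')" if "r \<in> set vs" "r' \<in> set vs" for r r'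
    using *[OF that, of "-1"] by simp
qed

text \<open>One combination of rows, with coefficients \<open>y\<close>, is added \<open>x r\<close>
  times to row \<open>r\<close>. The result \<open>g\<close> is free up to an entrywise equation, so
  that each elimination stage can be given in closed form.\<close>

lemma row_transvection:
  assumes d: "distinct vs" and xy: "(\<Sum>k\<in>set vs. y k * x k) = 0"
    and g: "\<And>r c. r \<in> set vs \<Longrightarrow> c \<in> set vs \<Longrightarrow>
           g r c = f r c + x r * (\<Sum>k\<in>set vs. y k * f k c)"
  shows "list_mat vs vs f \<approx>\<^sub>u list_mat vs vs g"
proof -
  let ?P = "list_mat vs vs (\<lambda>r c. of_bool (r = c) + x r * y c)"
  have "list_mat vs vs g = ?P * list_mat vs vs f"
    unfolding list_mat_mult[OF d]
  proof (rule list_mat_cong)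
    fix r c assume rc: "r \<in> set vs" "c \<in> set vs"
    have "(\<Sum>k\<in>set vs. (of_bool (r = k) + x r * y k) * f k c)
        = (\<Sum>k\<in>set vs. if r = k then f k c else 0) + (\<Sum>k\<in>set vs. x r * (y k * f k c))"
      unfolding sum.distrib[symmetric] by (rule sum.cong) (auto simp: algebra_simps)
    then show "g r c = (\<Sum>k\<in>set vs. (of_bool (r = k) + x r * y k) * f k c)"
      using rc g[OF rc] by (simp add: sum_distrib_left)
  qed
  then have "list_mat vs vs g = ?P * list_mat vs vs f * 1\<^sub>m (length vs)"
    by (simp add: right_mult_one_mat[OF mult_carrier_mat[OF list_mat_carrier list_mat_carrier]])
  then show ?thesis
    unfolding unimodular_equiv_def
    using invertible_transvection[OF d xy]
    by (intro exI[of _ "length vs"] exI[of _ ?P] exI[of _ "1\<^sub>m (length vs)"]) (simp add: invertible_one_mat)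
qed

text \<open>Dual form: \<open>x\<close> weights the columns being combined, and \<open>y c\<close>
  says how often the combination is added to column \<open>c\<close>.\<close>

lemma col_transvection:
  assumes d: "distinct vs" and xy: "(\<Sum>k\<in>set vs. y k * x k) = 0"
    and g: "\<And>r c. r \<in> set vs \<Longrightarrow> c \<in> set vs \<Longrightarrow>
           g r c = f r c + (\<Sum>k\<in>set vs. f r k * x k) * y c"
  shows "list_mat vs vs f \<approx>\<^sub>u list_mat vs vs g"
proof -
  let ?Q = "list_mat vs vs (\<lambda>r c. of_bool (r = c) + x r * y c)"
  have "list_mat vs vs g = list_mat vs vs f * ?Q"
    unfolding list_mat_mult[OF d]
  proof (rule list_mat_cong)
    fix r c assume rc: "r \<in> set vs" "c \<in> set vs"
    have "(\<Sum>k\<in>set vs. f r k * (of_bool (k = c) + x k * y c))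
        = (\<Sum>k\<in>set vs. if c = k then f r k else 0) + (\<Sum>k\<in>set vs. (f r k * x k) * y c)"
      unfolding sum.distrib[symmetric] by (rule sum.cong) (auto simp: algebra_simps)
    then show "g r c = (\<Sum>k\<in>set vs. f r k * (of_bool (k = c) + x k * y c))"
      using rc g[OF rc] by (simp add: sum_distrib_right)
  qed
  then have "list_mat vs vs g = 1\<^sub>m (length vs) * list_mat vs vs f * ?Q"
    by (simp add: left_mult_one_mat[OF list_mat_carrier])
  then show ?thesis
    unfolding unimodular_equiv_def
    using invertible_transvection[OF d xy]
    by (intro exI[of _ "length vs"] exI[of _ "1\<^sub>m (length vs)"] exI[of _ ?Q]) (simp add: invertible_one_mat)
qed

text \<open>The left factor is a signed permutation matrix and the right one a permutation matrix;
  both are inverted by their transposes, since each sign squares to 1.\<close>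

lemma signed_reordering:
  fixes f :: "'a \<Rightarrow> 'a \<Rightarrow> int"
  assumes d: "distinct vs" "distinct rs" "distinct cs"
    and s: "set rs = set vs" "set cs = set vs"
    and e: "\<And>v. v \<in> set vs \<Longrightarrow> e v * e v = 1"
  shows "list_mat vs vs f \<approx>\<^sub>u list_mat rs cs (\<lambda>r c. e r * f r c)"
proof -
  let ?P = "list_mat rs vs (\<lambda>r c. if r = c then e r else 0)"
  let ?Q = "list_mat vs cs (\<lambda>r c. of_bool (r = c) :: int)"
  have len: "length rs = length vs" "length cs = length vs"
    using d s by (metis distinct_card)+
  have "list_mat rs cs (\<lambda>r c. e r * f r c) = ?P * list_mat vs vs f * ?Q"
    unfolding list_mat_mult[OF d(1)]
  proof (rule list_mat_cong)
    fix r c assume rc: "r \<in> set rs" "c \<in> set cs"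
    have inner: "(\<Sum>l\<in>set vs. (if r = l then e r else 0) * f l k) = e r * f r k" for k
    proof -
      have "(\<Sum>l\<in>set vs. (if r = l then e r else 0) * f l k)
          = (\<Sum>l\<in>set vs. if r = l then e r * f r k else 0)"
        by (rule sum.cong) auto
      then show ?thesis using rc s by simp
    qed
    have "(\<Sum>k\<in>set vs. (\<Sum>l\<in>set vs. (if r = l then e r else 0) * f l k) * of_bool (k = c))
        = (\<Sum>k\<in>set vs. if c = k then e r * f r c else 0)"
      unfolding inner by (rule sum.cong) auto
    also have "\<dots> = e r * f r c"
      using rc s by simp
    finally show "e r * f r c =
        (\<Sum>k\<in>set vs. (\<Sum>l\<in>set vs. (if r = l then e r else 0) * f l k) * of_bool (k = c))" ..
  qed
  moreover have "invertible_mat ?P"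
  proof (rule invertible_list_mat[OF d(2,1) len(1), where p' = "\<lambda>r c. if r = c then e r else 0"])
    show "(\<Sum>k\<in>set vs. (if r = k then e r else 0) * (if k = r' then e k else 0)) = of_bool (r = r')"
      if "r \<in> set rs" "r' \<in> set rs" for r r'
    proof -
      have "(\<Sum>k\<in>set vs. (if r = k then e r else 0) * (if k = r' then e k else 0))
          = (\<Sum>k\<in>set vs. if r = k then of_bool (r = r') else 0)"
        by (rule sum.cong) (auto simp: e)
      then show ?thesis using that s by simp
    qed
    then show "(\<Sum>k\<in>set rs. (if r = k then e r else 0) * (if k = r' then e k else 0)) = of_bool (r = r')"
      if "r \<in> set vs" "r' \<in> set vs" for r r'
      using that s by simp
  qed
  moreover have "invertible_mat ?Q"
  proof (rule invertible_list_mat[OF d(1,3) len(2)[symmetric], where p' = "\<lambda>r c. of_bool (r = c)"])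
    show "(\<Sum>k\<in>set cs. of_bool (r = k) * of_bool (k = r') :: int) = of_bool (r = r')"
      if "r \<in> set vs" "r' \<in> set vs" for r r'
    proof -
      have "(\<Sum>k\<in>set cs. of_bool (r = k) * of_bool (k = r') :: int)
          = (\<Sum>k\<in>set cs. if r = k then of_bool (r = r') else 0)"
        by (rule sum.cong) auto
      then show ?thesis using that s by simp
    qed
    then show "(\<Sum>k\<in>set vs. of_bool (r = k) * of_bool (k = r') :: int) = of_bool (r = r')"
      if "r \<in> set cs" "r' \<in> set cs" for r r'
      using that s by simp
  qed
  moreover have "?P \<in> carrier_mat (length vs) (length vs)" "?Q \<in> carrier_mat (length vs) (length vs)"
    using list_mat_carrier[of rs vs] list_mat_carrier[of vs cs] len by simp_all
  ultimately show ?thesis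
    unfolding unimodular_equiv_def
    by (intro exI[of _ "length vs"] exI[of _ ?P] exI[of _ ?Q]) simp
qed

section \<open>Diagonal matrices and the Smith normal form\<close>

abbreviation list_diag :: "'a::zero list \<Rightarrow> 'a mat" where
  "list_diag fs \<equiv> mat_diag (length fs) (\<lambda>i. fs ! i)"

lemma list_diag_append:
  "list_diag (xs @ ys) = four_block_mat (list_diag xs) (0\<^sub>m (length xs) (length ys))
     (0\<^sub>m (length ys) (length xs)) (list_diag ys)"
  by (rule eq_matI) (auto simp: mat_diag_def nth_append)

lemma diag_block_mat_list_diag: "diag_block_mat (map list_diag fss) = list_diag (concat fss)"
proof (induction fss)
  case Nil
  show ?case by (auto simp: mat_diag_def)
next
  case (Cons xs fss)
  then show ?case
    by (simp add: Let_def list_diag_append[unfolded length_append] carrier_matD[OF mat_diag_dim])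
qed

lemma list_diag_replicate: "list_diag (replicate k c) = c \<cdot>\<^sub>m (1\<^sub>m k :: 'a::semiring_1 mat)"
  by (rule eq_matI) (auto simp: mat_diag_def)

lemma list_diag_ones: "list_diag (replicate k 1) = (1\<^sub>m k :: 'a::semiring_1 mat)"
  by (rule eq_matI) (auto simp: mat_diag_def)

lemma list_diag_singleton: "list_diag [c] = mat 1 1 (\<lambda>_. c)"
  by (rule eq_matI) (auto simp: mat_diag_def)

text \<open>Listing the columns in the order of the rows they are matched with by
  \<open>\<sigma>\<close> makes a generalized permutation matrix diagonal.\<close>

lemma list_mat_eq_list_diag:
  assumes "distinct rs"
    and "\<And>r r'. r \<in> set rs \<Longrightarrow> r' \<in> set rs \<Longrightarrow> f r (\<sigma> r') = (if r = r' then d r else 0)"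
  shows "list_mat rs (map \<sigma> rs) f = list_diag (map d rs)"
  using assms by (auto simp: list_mat_def mat_diag_def nth_eq_iff_index_eq intro!: eq_matI)

text \<open>The nonsingular case: \<open>fs\<close> fills the whole diagonal.\<close>

lemma smith_normal_formI:
  assumes eq: "M \<approx>\<^sub>u list_diag fs"
    and "\<forall>f \<in> set fs. f > 0" "\<forall>i. Suc i < length fs \<longrightarrow> fs ! i dvd fs ! Suc i"
  shows "is_smith_normal_form M (list_diag fs)"
proof -
  obtain n P Q where 1: "M \<in> carrier_mat n n" "P \<in> carrier_mat n n" "invertible_mat P"
     "Q \<in> carrier_mat n n" "invertible_mat Q" "list_diag fs = P * M * Q"
    using eq unfolding unimodular_equiv_def by blast
  then have n: "n = length fs"
    using carrier_matD(1)[OF mat_diag_dim[of "length fs" "\<lambda>i. fs ! i"]] by simp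
  have "list_diag fs = mat_diag n (\<lambda>i. if i < length fs then fs ! i else 0)"
    unfolding n by (auto simp: mat_diag_def)
  then show ?thesis
    unfolding is_smith_normal_form_def using assms 1 n
    by (intro exI[of _ n] exI[of _ fs] exI[of _ P] exI[of _ Q]) auto
qed

section \<open>Distances in the digraph\<close>

fun lambda_dist :: "lambda_vertex \<Rightarrow> lambda_vertex \<Rightarrow> int" where
  "lambda_dist (U i) (U i') = (if i = i' then 0 else 1)"
| "lambda_dist (U i) (W j) = 1"
| "lambda_dist (U i) V = 2"
| "lambda_dist (W j) (U i) = 2"
| "lambda_dist (W j) (W j') = (if j = j' then 0 else 2)"
| "lambda_dist (W j) V = 1"
| "lambda_dist V (U i) = 1"
| "lambda_dist V (W j) = 1"
| "lambda_dist V V = 0"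

lemma digraph_dist_eqI:
  assumes "pre_digraph.awalk G u p v" "length p = k"
    and "\<And>q. pre_digraph.awalk G u q v \<Longrightarrow> k \<le> length q"
  shows "digraph_dist G u v = k"
  unfolding digraph_dist_def by (rule Least_equality) (use assms in blast)+

lemma digraph_dist_self:
  assumes "u \<in> verts G" shows "digraph_dist G u u = 0"
  by (rule digraph_dist_eqI[where p = "[]"])
    (use assms in \<open>auto simp: pre_digraph.awalk_def pre_digraph.cas.simps\<close>)

lemma digraph_dist_arc:
  assumes "u \<in> verts G" "e \<in> arcs G" "tail G e = u" "head G e = v" "u \<noteq> v"
  shows "digraph_dist G u v = 1"
proof (rule digraph_dist_eqI[where p = "[e]"])
  show "1 \<le> length q" if "pre_digraph.awalk G u q v" for q
    using that assms by (cases q) (auto simp: pre_digraph.awalk_def pre_digraph.cas.simps)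
qed (use assms in \<open>auto simp: pre_digraph.awalk_def pre_digraph.cas.simps\<close>)

text \<open>The two arcs give the upper bound; \<open>u \<noteq> v\<close> excludes the empty walk
  and the last hypothesis a single arc.\<close>

lemma digraph_dist_two:
  assumes "u \<in> verts G" "e \<in> arcs G" "e' \<in> arcs G"
    and "tail G e = u" "tail G e' = head G e" "head G e' = v" "u \<noteq> v"
    and "\<And>e. e \<in> arcs G \<Longrightarrow> tail G e = u \<Longrightarrow> head G e \<noteq> v"
  shows "digraph_dist G u v = 2"
proof (rule digraph_dist_eqI[where p = "[e, e']"])
  show "2 \<le> length q" if "pre_digraph.awalk G u q v" for q
  proof (rule ccontr)
    assume "\<not> 2 \<le> length q"
    then consider "q = []" | d where "q = [d]"
      by (cases q; cases "tl q") auto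
    then show False
      using that assms by cases (auto simp: pre_digraph.awalk_def pre_digraph.cas.simps)
  qed
qed (use assms in \<open>auto simp: pre_digraph.awalk_def pre_digraph.cas.simps\<close>)

lemma digraph_dist_Lambda01:
  assumes "b \<ge> 1" "u \<in> verts (Lambda01 a b)" "v \<in> verts (Lambda01 a b)"
  shows "int (digraph_dist (Lambda01 a b) u v) = lambda_dist u v"
proof -
  let ?G = "Lambda01 a b"
  have arcs [simp]: "(U i, U j) \<in> arcs ?G \<longleftrightarrow> i \<in> {1..a} \<and> j \<in> {1..a} \<and> i \<noteq> j"
    "(U i, W j) \<in> arcs ?G \<longleftrightarrow> i \<in> {1..a} \<and> j \<in> {1..b}"
    "(U i, V) \<notin> arcs ?G"
    "(W i, U j) \<notin> arcs ?G" "(W i, W j) \<notin> arcs ?G" "(W i, V) \<in> arcs ?G \<longleftrightarrow> i \<in> {1..b}"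
    "(V, U j) \<in> arcs ?G \<longleftrightarrow> j \<in> {1..a}" "(V, W j) \<in> arcs ?G \<longleftrightarrow> j \<in> {1..b}"
    "(V, V) \<notin> arcs ?G" for i j
    unfolding Lambda01_def by auto
  have th [simp]: "tail ?G = fst" "head ?G = snd"
    and vs [simp]: "U i \<in> verts ?G \<longleftrightarrow> i \<in> {1..a}" "W i \<in> verts ?G \<longleftrightarrow> i \<in> {1..b}"
      "V \<in> verts ?G" for i
    unfolding Lambda01_def by auto
  have one: "digraph_dist ?G x y = 1" if "(x, y) \<in> arcs ?G" "x \<noteq> y" "x \<in> verts ?G" for x y
    using that by (intro digraph_dist_arc[where e = "(x, y)"]) auto
  have two: "digraph_dist ?G x y = 2"
    if "(x, z) \<in> arcs ?G" "(z, y) \<in> arcs ?G" "(x, y) \<notin> arcs ?G" "x \<noteq> y" "x \<in> verts ?G" for x y z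
    using that by (intro digraph_dist_two[where e = "(x, z)" and e' = "(z, y)"]) auto
  show ?thesis
    using assms
    \<comment> \<open>Pairs at distance 2 starting in some \<open>W j\<close> pass through
      \<open>V\<close>. From \<open>U i\<close> to \<open>V\<close> the midpoint is
      \<open>W 1\<close>, a vertex because \<open>b \<ge> 1\<close>.\<close>
    by (cases u; cases v)
      (auto simp: digraph_dist_self one two[where z = V] two[where z = "W 1"])
qed

section \<open>Elimination on the distance matrix\<close>

lemma mem_verts_Lambda01:
  "U i \<in> verts (Lambda01 a b) \<longleftrightarrow> i \<in> {1..a}" "W j \<in> verts (Lambda01 a b) \<longleftrightarrow> j \<in> {1..b}"
  "V \<in> verts (Lambda01 a b)"
  by (auto simp: Lambda01_def)

text \<open>Brings products under a sum into the conditional shape that the simplifier collapses to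
  a single term.\<close>

lemma mult_if_zero:
  fixes x z :: "'a::mult_zero"
  shows "(if P then x else 0) * z = (if P then x * z else 0)"
    and "z * (if P then x else 0) = (if P then z * x else 0)"
  by simp_all

lemma sum_Lambda01:
  fixes F :: "lambda_vertex \<Rightarrow> int"
  shows "(\<Sum>k\<in>verts (Lambda01 a b). F k) = (\<Sum>i=1..a. F (U i)) + (\<Sum>j=1..b. F (W j)) + F V"
proof -
  have "(\<Sum>k\<in>verts (Lambda01 a b). F k)
      = (\<Sum>k\<in>U ` {1..a}. F k) + (\<Sum>k\<in>W ` {1..b}. F k) + F V"
    unfolding Lambda01_def
    by (subst pre_digraph.simps, subst sum.union_disjoint, simp, simp, force,
        subst sum.union_disjoint) auto
  then show ?thesis
    by (simp add: sum.reindex inj_on_def)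
qed

text \<open>
  The successive stages of the elimination, each reached from the previous one by one transvection
  (\<open>elim1\<close> from \<open>lambda_dist\<close>), where \<open>r\<^sub>x\<close> and \<open>c\<^sub>x\<close> are the row and column of the vertex \<open>x\<close>:
  \<^item> \<open>elim1\<close>: subtract \<open>r\<^sub>V\<close> from every \<open>r\<^sub>U\<close> and twice from every \<open>r\<^sub>W\<close>;
  \<^item> \<open>elim2\<close>: add every \<open>c\<^sub>U\<close> twice to \<open>c\<^sub>V\<close>;
  \<^item> \<open>elim3\<close>: add every \<open>r\<^sub>U\<close> to \<open>r\<^sub>V\<close>;
  \<^item> \<open>elim4\<close>: subtract the row of \<open>W 1\<close> from the other \<open>r\<^sub>W\<close> and \<open>2 a\<close> times from \<open>r\<^sub>V\<close>;
  \<^item> \<open>elim5\<close>: add \<open>2 c\<^sub>V\<close> and every other \<open>c\<^sub>W\<close> to the column of \<open>W 1\<close>.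

  For \<open>b = 1\<close> this is already a signed generalized permutation matrix.  For \<open>b \<ge> 2\<close> the entry
  at \<open>(V, W 2)\<close> serves as the next pivot:
  \<^item> \<open>elim6\<close>: subtract the column of \<open>W 2\<close> from those of \<open>W 3, \<dots>, W b\<close> and \<open>4 a + b\<close> times
    from that of \<open>W 1\<close>;
  \<^item> \<open>elim7\<close>: add \<open>2 r\<^sub>V\<close> and the rows of \<open>W 3, \<dots>, W b\<close> to that of \<open>W 2\<close>.
\<close>

fun elim1 :: "lambda_vertex \<Rightarrow> lambda_vertex \<Rightarrow> int" where
  "elim1 (U i) (U i') = (if i = i' then -1 else 0)"
| "elim1 (U i) V = 2"
| "elim1 V (U i) = 1"
| "elim1 (W j) (W j') = (if j = j' then -2 else 0)"
| "elim1 (W j) V = 1"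
| "elim1 V (W j) = 1"
| "elim1 _ _ = 0"

fun elim2 :: "nat \<Rightarrow> lambda_vertex \<Rightarrow> lambda_vertex \<Rightarrow> int" where
  "elim2 a (U i) (U i') = (if i = i' then -1 else 0)"
| "elim2 a V (U i) = 1"
| "elim2 a (W j) (W j') = (if j = j' then -2 else 0)"
| "elim2 a (W j) V = 1"
| "elim2 a V (W j) = 1"
| "elim2 a V V = 2 * int a"
| "elim2 a _ _ = 0"

fun elim3 :: "nat \<Rightarrow> lambda_vertex \<Rightarrow> lambda_vertex \<Rightarrow> int" where
  "elim3 a (U i) (U i') = (if i = i' then -1 else 0)"
| "elim3 a (W j) (W j') = (if j = j' then -2 else 0)"
| "elim3 a (W j) V = 1"
| "elim3 a V (W j) = 1"
| "elim3 a V V = 2 * int a"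
| "elim3 a _ _ = 0"

fun elim4 :: "nat \<Rightarrow> lambda_vertex \<Rightarrow> lambda_vertex \<Rightarrow> int" where
  "elim4 a (U i) (U i') = (if i = i' then -1 else 0)"
| "elim4 a (W j) (W j') = (if j = 1 then (if j' = 1 then -2 else 0) else
      if j' = 1 then 2 else if j = j' then -2 else 0)"
| "elim4 a (W j) V = (if j = 1 then 1 else 0)"
| "elim4 a V (W j) = (if j = 1 then 1 + 4 * int a else 1)"
| "elim4 a _ _ = 0"

fun elim5 :: "nat \<Rightarrow> nat \<Rightarrow> lambda_vertex \<Rightarrow> lambda_vertex \<Rightarrow> int" where
  "elim5 a b (U i) (U i') = (if i = i' then -1 else 0)"
| "elim5 a b (W j) (W j') = (if j \<noteq> 1 \<and> j = j' then -2 else 0)"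
| "elim5 a b (W j) V = (if j = 1 then 1 else 0)"
| "elim5 a b V (W j) = (if j = 1 then 4 * int a + int b else 1)"
| "elim5 a b _ _ = 0"

fun elim6 :: "nat \<Rightarrow> nat \<Rightarrow> lambda_vertex \<Rightarrow> lambda_vertex \<Rightarrow> int" where
  "elim6 a b (U i) (U i') = (if i = i' then -1 else 0)"
| "elim6 a b (W j) (W j') = (if j = 2 then
      (if j' = 1 then 2 * (4 * int a + int b) else if j' = 2 then -2 else 2)
      else if j \<noteq> 1 \<and> j = j' then -2 else 0)"
| "elim6 a b (W j) V = (if j = 1 then 1 else 0)"
| "elim6 a b V (W j) = (if j = 2 then 1 else 0)"
| "elim6 a b _ _ = 0"

fun elim7 :: "nat \<Rightarrow> nat \<Rightarrow> lambda_vertex \<Rightarrow> lambda_vertex \<Rightarrow> int" where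
  "elim7 a b (U i) (U i') = (if i = i' then -1 else 0)"
| "elim7 a b (W j) (W j') = (if j = 2 then (if j' = 1 then 8 * int a + 2 * int b else 0)
      else if j \<noteq> 1 \<and> j = j' then -2 else 0)"
| "elim7 a b (W j) V = (if j = 1 then 1 else 0)"
| "elim7 a b V (W j) = (if j = 2 then 1 else 0)"
| "elim7 a b _ _ = 0"

text \<open>Splits off the \<open>U\<close> block as a negated identity, then uses the 1 at
  \<open>(W 1, V)\<close> to clear the rest of column \<open>V\<close>.\<close>

lemma lambda_dist_equiv_elim4:
  assumes vs: "distinct vs" "set vs = verts (Lambda01 a b)" and b: "b \<ge> 1"
  shows "list_mat vs vs lambda_dist \<approx>\<^sub>u list_mat vs vs (elim4 a)"
proof -
  have b': "{Suc 0..b} = insert 1 {2..b}" using b by auto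
  note sums = vs(2) sum_Lambda01 mult_if_zero
  have "list_mat vs vs lambda_dist \<approx>\<^sub>u list_mat vs vs elim1"
  \<comment> \<open>Here and in all later stages \<open>x\<close> and \<open>y\<close> have disjoint
    supports, so the condition that their product sums to zero holds term by term.\<close>
  proof (rule row_transvection[OF vs(1), where y = "case_lambda_vertex (\<lambda>_. 0) (\<lambda>_. 0) 1"
          and x = "case_lambda_vertex (\<lambda>_. - 1) (\<lambda>_. - 2) 0"])
    show "elim1 r c = lambda_dist r c + case_lambda_vertex (\<lambda>_. - 1) (\<lambda>_. - 2) 0 r *
        (\<Sum>k\<in>set vs. case_lambda_vertex (\<lambda>_. 0) (\<lambda>_. 0) 1 k * lambda_dist k c)" for r c
      by (cases r; cases c) (auto simp: sums)
  qed (auto simp: sums)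
  also have "\<dots> \<approx>\<^sub>u list_mat vs vs (elim2 a)"
  proof (rule col_transvection[OF vs(1), where x = "case_lambda_vertex (\<lambda>_. 2) (\<lambda>_. 0) 0"
          and y = "case_lambda_vertex (\<lambda>_. 0) (\<lambda>_. 0) 1"])
    show "elim2 a r c = elim1 r c + (\<Sum>k\<in>set vs. elim1 r k * case_lambda_vertex (\<lambda>_. 2) (\<lambda>_. 0) 0 k) *
       case_lambda_vertex (\<lambda>_. 0) (\<lambda>_. 0) 1 c" if "r \<in> set vs" "c \<in> set vs" for r c
      \<comment> \<open>Unlike in the first stage, a sum over the \<open>U\<close> indices must now
        collapse to one term, which requires the index to lie in \<open>{1..a}\<close>.\<close>
      using that
      by (cases r rule: lambda_vertex.exhaust; cases c rule: lambda_vertex.exhaust)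
        (auto simp: sums mem_verts_Lambda01)
  qed (auto simp: sums)
  also have "\<dots> \<approx>\<^sub>u list_mat vs vs (elim3 a)"
  proof (rule row_transvection[OF vs(1), where y = "case_lambda_vertex (\<lambda>_. 1) (\<lambda>_. 0) 0"
          and x = "case_lambda_vertex (\<lambda>_. 0) (\<lambda>_. 0) 1"])
    show "elim3 a r c = elim2 a r c + case_lambda_vertex (\<lambda>_. 0) (\<lambda>_. 0) 1 r *
        (\<Sum>k\<in>set vs. case_lambda_vertex (\<lambda>_. 1) (\<lambda>_. 0) 0 k * elim2 a k c)"
      if "r \<in> set vs" "c \<in> set vs" for r c
      using that
      by (cases r rule: lambda_vertex.exhaust; cases c rule: lambda_vertex.exhaust)
        (auto simp: sums mem_verts_Lambda01)
  qed (auto simp: sums)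
  also have "\<dots> \<approx>\<^sub>u list_mat vs vs (elim4 a)"
  proof (rule row_transvection[OF vs(1),
          where y = "case_lambda_vertex (\<lambda>_. 0) (\<lambda>j. if j = 1 then 1 else 0) 0"
          and x = "case_lambda_vertex (\<lambda>_. 0) (\<lambda>j. if j = 1 then 0 else - 1) (- 2 * int a)"])
    show "elim4 a r c = elim3 a r c +
        case_lambda_vertex (\<lambda>_. 0) (\<lambda>j. if j = 1 then 0 else - 1) (- 2 * int a) r *
        (\<Sum>k\<in>set vs. case_lambda_vertex (\<lambda>_. 0) (\<lambda>j. if j = 1 then 1 else 0) 0 k * elim3 a k c)"
      if "r \<in> set vs" "c \<in> set vs" for r c
      using that
      by (cases r rule: lambda_vertex.exhaust; cases c rule: lambda_vertex.exhaust)
        (auto simp: sums mem_verts_Lambda01 b')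
  qed (auto simp: sums intro!: sum.neutral)
  finally show ?thesis .
qed

lemma elim4_equiv_elim5:
  assumes vs: "distinct vs" "set vs = verts (Lambda01 a b)" and b: "b \<ge> 1"
  shows "list_mat vs vs (elim4 a) \<approx>\<^sub>u list_mat vs vs (elim5 a b)"
proof -
  have b': "{Suc 0..b} = insert 1 {2..b}" using b by auto
  note sums = vs(2) sum_Lambda01 mult_if_zero
  show ?thesis
  proof (rule col_transvection[OF vs(1),
          where x = "case_lambda_vertex (\<lambda>_. 0) (\<lambda>j. if j = 1 then 0 else 1) 2"
          and y = "case_lambda_vertex (\<lambda>_. 0) (\<lambda>j. if j = 1 then 1 else 0) 0"])
    show "elim5 a b r c = elim4 a r c +
        (\<Sum>k\<in>set vs. elim4 a r k * case_lambda_vertex (\<lambda>_. 0) (\<lambda>j. if j = 1 then 0 else 1) 2 k) *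
        case_lambda_vertex (\<lambda>_. 0) (\<lambda>j. if j = 1 then 1 else 0) 0 c"
      if "r \<in> set vs" "c \<in> set vs" for r c
      \<comment> \<open>In row \<open>V\<close> the \<open>b - 1\<close> unit entries at the other
        \<open>W\<close> columns raise \<open>1 + 4 * int a\<close> to
        \<open>4 * int a + int b\<close>.\<close>
      using that b
      by (cases r rule: lambda_vertex.exhaust; cases c rule: lambda_vertex.exhaust)
        (auto simp: sums mem_verts_Lambda01 b' of_nat_diff)
  qed (auto simp: sums intro!: sum.neutral)
qed

text \<open>Clearing row \<open>V\<close> with the column of \<open>W 2\<close>, whose diagonal
  entry is -2, creates twice \<open>4 * int a + int b\<close> in row \<open>W 2\<close>: this is the
  source of the last invariant factor.\<close>

lemma elim5_equiv_elim7:
  assumes vs: "distinct vs" "set vs = verts (Lambda01 a b)" and b: "b \<ge> 2"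
  shows "list_mat vs vs (elim5 a b) \<approx>\<^sub>u list_mat vs vs (elim7 a b)"
proof -
  have b': "{Suc 0..b} = insert 1 (insert 2 {3..b})" using b by auto
  note sums = vs(2) sum_Lambda01 mult_if_zero
  have "list_mat vs vs (elim5 a b) \<approx>\<^sub>u list_mat vs vs (elim6 a b)"
  proof (rule col_transvection[OF vs(1),
          where x = "case_lambda_vertex (\<lambda>_. 0) (\<lambda>j. if j = 2 then 1 else 0) 0"
          and y = "case_lambda_vertex (\<lambda>_. 0)
             (\<lambda>j. if j = 1 then - (4 * int a + int b) else if j = 2 then 0 else -1) 0"])
    show "elim6 a b r c = elim5 a b r c +
        (\<Sum>k\<in>set vs. elim5 a b r k * case_lambda_vertex (\<lambda>_. 0) (\<lambda>j. if j = 2 then 1 else 0) 0 k) *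
        case_lambda_vertex (\<lambda>_. 0)
             (\<lambda>j. if j = 1 then - (4 * int a + int b) else if j = 2 then 0 else -1) 0 c"
      if "r \<in> set vs" "c \<in> set vs" for r c
      using that
      by (cases r rule: lambda_vertex.exhaust; cases c rule: lambda_vertex.exhaust)
        (auto simp: sums mem_verts_Lambda01 b')
  qed (auto simp: sums intro!: sum.neutral)
  also have "\<dots> \<approx>\<^sub>u list_mat vs vs (elim7 a b)"
  proof (rule row_transvection[OF vs(1),
          where x = "case_lambda_vertex (\<lambda>_. 0) (\<lambda>j. if j = 2 then 1 else 0) 0"
          and y = "case_lambda_vertex (\<lambda>_. 0) (\<lambda>j. if j \<le> 2 then 0 else 1) 2"])
    show "elim7 a b r c = elim6 a b r c +
        case_lambda_vertex (\<lambda>_. 0) (\<lambda>j. if j = 2 then 1 else 0) 0 r *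
        (\<Sum>k\<in>set vs. case_lambda_vertex (\<lambda>_. 0) (\<lambda>j. if j \<le> 2 then 0 else 1) 2 k * elim6 a b k c)"
      if "r \<in> set vs" "c \<in> set vs" for r c
      using that
      by (cases r rule: lambda_vertex.exhaust; cases c rule: lambda_vertex.exhaust)
        (auto simp: sums mem_verts_Lambda01 b')
  qed (auto simp: sums intro!: sum.neutral)
  finally show ?thesis .
qed

section \<open>Reading off the invariant factors\<close>

theorem theorem19:
  fixes a b :: nat and vs :: "lambda_vertex list"
  assumes "b \<ge> 1"
    and "distinct vs" and "set vs = verts (Lambda01 a b)"
  shows "(b \<ge> 2 \<longrightarrow>
            is_smith_normal_form (distance_mat (Lambda01 a b) vs)
              (diag_block_mat [1\<^sub>m (a + 2), 2 \<cdot>\<^sub>m 1\<^sub>m (b - 2),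
                 mat 1 1 (\<lambda>_. 8 * int a + 2 * int b)])) \<and>
         (b = 1 \<longrightarrow>
            is_smith_normal_form (distance_mat (Lambda01 a b) vs)
              (diag_block_mat [1\<^sub>m (a + 1), mat 1 1 (\<lambda>_. 4 * int a + 1)]))"
proof -
  note vs = assms(2,3)
  have "distance_mat (Lambda01 a b) vs = list_mat vs vs lambda_dist"
    unfolding distance_mat_def list_mat_def
    by (intro eq_matI) (auto simp: digraph_dist_Lambda01[OF assms(1)] vs(2)[symmetric])
  also have "\<dots> \<approx>\<^sub>u list_mat vs vs (elim4 a)" by (rule lambda_dist_equiv_elim4[OF vs assms(1)])
  also have "\<dots> \<approx>\<^sub>u list_mat vs vs (elim5 a b)" by (rule elim4_equiv_elim5[OF vs assms(1)])
  finally have equiv_elim5: "distance_mat (Lambda01 a b) vs \<approx>\<^sub>u list_mat vs vs (elim5 a b)" .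
  show ?thesis
  proof (intro conjI impI)
    assume b: "b \<ge> 2"
    let ?ds = "[replicate (a + 2) 1, replicate (b - 2) 2, [8 * int a + 2 * int b]]"
    let ?fs = "concat ?ds"
    \<comment> \<open>The rows are ordered by invariant factor: the ones, then the twos, then
      \<open>W 2\<close> with the largest. In \<open>elim7\<close> the nonzero entry of each row
      lies in the column given by \<open>?\<sigma>\<close>, which cycles \<open>W 1\<close>,
      \<open>V\<close>, \<open>W 2\<close>; \<open>?e\<close> is its sign and \<open>?d\<close> its
      absolute value.\<close>
    let ?rs = "[W 1, V] @ map U [1..<Suc a] @ map W [3..<Suc b] @ [W 2]"
    let ?\<sigma> = "\<lambda>r. if r = W 1 then V else if r = V then W 2 else if r = W 2 then W 1 else r"
    let ?e = "case_lambda_vertex (\<lambda>_. - 1) (\<lambda>j. if j \<le> 2 then 1 else - 1) 1 :: lambda_vertex \<Rightarrow> int"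
    let ?d = "case_lambda_vertex (\<lambda>_. 1)
      (\<lambda>j. if j = 1 then 1 else if j = 2 then 8 * int a + 2 * int b else 2) 1"
    have rs: "distinct ?rs" "set ?rs = set vs"
      unfolding vs(2) using b by (auto simp: distinct_map inj_on_def Lambda01_def image_iff)
    note equiv_elim5
    also have "list_mat vs vs (elim5 a b) \<approx>\<^sub>u list_mat vs vs (elim7 a b)"
      by (rule elim5_equiv_elim7[OF vs b])
    also have "\<dots> \<approx>\<^sub>u list_mat ?rs (map ?\<sigma> ?rs) (\<lambda>r c. ?e r * elim7 a b r c)"
    proof (rule signed_reordering[OF vs(1) rs(1) _ rs(2)])
      show "distinct (map ?\<sigma> ?rs)"
        unfolding distinct_map using rs(1) by (auto simp: inj_on_def split: if_splits)
      have "?\<sigma> ` set ?rs = set ?rs" by (auto simp: image_iff)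
      then show "set (map ?\<sigma> ?rs) = set vs" unfolding set_map rs(2) .
      show "?e v * ?e v = 1" for v by (cases v) auto
    qed
    also have "\<dots> = list_diag (map ?d ?rs)"
      by (rule list_mat_eq_list_diag[OF rs(1)])
        (auto split: lambda_vertex.splits)
    also have "map ?d ?rs = ?fs"
    proof -
      have "map ?d (map U [1..<Suc a]) = replicate a 1"
        by (simp add: map_replicate_const comp_def del: upt_Suc)
      moreover have "map ?d (map W [3..<Suc b]) = replicate (b - 2) 2"
        by (rule nth_equalityI) (auto simp del: upt_Suc)
      ultimately show ?thesis unfolding map_append by simp
    qed
    finally have "is_smith_normal_form (distance_mat (Lambda01 a b) vs) (list_diag ?fs)"
      \<comment> \<open>Beyond divisibility by 1 only \<open>2 dvd 8 * int a + 2 * int b\<close> is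
        at stake; for \<open>b = 2\<close> the middle block is empty.\<close>
      by (rule smith_normal_formI) (use b in \<open>auto simp: nth_append nth_Cons'\<close>)
    also have "list_diag ?fs = diag_block_mat
        [1\<^sub>m (a + 2), 2 \<cdot>\<^sub>m 1\<^sub>m (b - 2), mat 1 1 (\<lambda>_. 8 * int a + 2 * int b)]"
      unfolding diag_block_mat_list_diag[symmetric] list.map list_diag_ones list_diag_singleton
      \<comment> \<open>Applied last, since this rule would also turn the block of ones into a
        scalar multiple.\<close>
      unfolding list_diag_replicate ..
    finally show "is_smith_normal_form (distance_mat (Lambda01 a b) vs) \<dots>" .
  next
    assume b: "b = 1"
    let ?ds = "[replicate (a + 1) 1, [4 * int a + 1]]"
    let ?fs = "concat ?ds"
    \<comment> \<open>With one \<open>W\<close> vertex, \<open>elim5\<close> already has a single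
      nonzero entry per row; \<open>?\<sigma>\<close> swaps \<open>W 1\<close> and \<open>V\<close>,
      and row \<open>V\<close> carries \<open>4 * int a + 1\<close>.\<close>
    let ?rs = "[W 1] @ map U [1..<Suc a] @ [V]"
    let ?\<sigma> = "\<lambda>r. if r = W 1 then V else if r = V then W 1 else r"
    let ?e = "case_lambda_vertex (\<lambda>_. - 1) (\<lambda>_. 1) 1 :: lambda_vertex \<Rightarrow> int"
    let ?d = "case_lambda_vertex (\<lambda>_. 1) (\<lambda>_. 1) (4 * int a + 1)"
    have rs: "distinct ?rs" "set ?rs = set vs"
      unfolding vs(2) using b by (auto simp: distinct_map inj_on_def Lambda01_def image_iff)
    note equiv_elim5
    also have "list_mat vs vs (elim5 a b) \<approx>\<^sub>u list_mat ?rs (map ?\<sigma> ?rs) (\<lambda>r c. ?e r * elim5 a b r c)"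
    proof (rule signed_reordering[OF vs(1) rs(1) _ rs(2)])
      show "distinct (map ?\<sigma> ?rs)"
        unfolding distinct_map using rs(1) by (auto simp: inj_on_def split: if_splits)
      have "?\<sigma> ` set ?rs = set ?rs" by (auto simp: image_iff)
      then show "set (map ?\<sigma> ?rs) = set vs" unfolding set_map rs(2) .
      show "?e v * ?e v = 1" for v by (cases v) auto
    qed
    also have "\<dots> = list_diag (map ?d ?rs)"
      by (rule list_mat_eq_list_diag[OF rs(1)]) (use b in \<open>auto split: lambda_vertex.splits\<close>)
    also have "map ?d ?rs = ?fs"
    proof -
      have "map ?d (map U [1..<Suc a]) = replicate a 1"
        by (simp add: map_replicate_const comp_def del: upt_Suc)
      then show ?thesis unfolding map_append by simp
    qed
    finally have "is_smith_normal_form (distance_mat (Lambda01 a b) vs) (list_diag ?fs)"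
      by (rule smith_normal_formI) (auto simp: nth_append nth_Cons')
    also have "list_diag ?fs = diag_block_mat [1\<^sub>m (a + 1), mat 1 1 (\<lambda>_. 4 * int a + 1)]"
      unfolding diag_block_mat_list_diag[symmetric] list.map list_diag_ones list_diag_singleton ..
    finally show "is_smith_normal_form (distance_mat (Lambda01 a b) vs) \<dots>" .
  qed
qed

end
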